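(* The total order $\leq$ on the class of numbers has the following properties. (1) It extends inclusion: for numbers $x,y$, if $x\subset y$ then $x\le y$. (2) The map $x\mapsto x^\sharp$ is an order-reversing bijection of the class of numbers, fixing $0_{\mathrm{Co}}$. (3) For each ordinal $\alpha$ and each number $x$ with $\mathrm{b}(x)=\alpha$: the right child $x_+$ is an immediate successor of $x$ for $\le$ in $\mathbb{NO}_{\alpha+2}$, and the left child $x_-$ is an immediate predecessor of $x$ for $\le$ in $\mathbb{NO}_{\alpha+2}$. (4) For every number $x$: $0_{\mathrm{Co}}\le x$ iff $0\in x$, iff $\mathrm{sgn}(x)=1$; $0_{\mathrm{Co}}\le x<1_{\mathrm{Co}}$ iff ($0\in x$ and $1\notin x$), iff $\mathrm{t}(x)=0$; $1_{\mathrm{Co}}\le x$ iff $\{0,1\}\subset x$; and, for every ordinal $\alpha$, $\alpha_{\mathrm{Co}}\le x$ iff $\alpha_{\mathrm{Co}}\subset x$. (5) For every ordinal $\alpha$, $\alpha_{\mathrm{Co}}$ is a maximal element and $\{\alpha\}$ is a minimal element of $\mathbb{NO}_{\alpha+1}$ for $\le$.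
   Context: A number is a set $x$ of (von Neumann) ordinals having a maximal element $\mathrm{b}(x)$ (birthday). $\mathbb{NO}_\alpha:=\{x\text{ number}\mid\mathrm{b}(x)<\alpha\}$. The total order is: $x<y$ iff $x\ne y$ and $\min(x\Delta y)\in y$ ($\Delta$ = symmetric difference). $x^\sharp:=\{\alpha<\mathrm{b}(x)\mid\alpha\notin x\}\cup\{\mathrm{b}(x)\}$. Children: $x_+:=x\cup\{\mathrm{b}(x)+1\}$, $x_-:=(x\cup\{\mathrm{b}(x)+1\})\setminus\{\mathrm{b}(x)\}$. For an ordinal $\alpha$, $\alpha_{\mathrm{Co}}:=\alpha+1=\{\beta\mid\beta\le\alpha\}$; so $0_{\mathrm{Co}}=\{0\}$, $1_{\mathrm{Co}}=\{0,1\}$. $\mathrm{sgn}(x):=1$ if $0\in x$ and $-1$ if $0\notin x$. Tipping element: $\mathrm{t}(x):=\min\{\alpha\in x\mid\alpha+1\notin x\text{ or }\exists\beta\notin x:\alpha=\beta+1\}$. In an ordered set, $b$ is an immediate successor of $a$ (and $a$ an immediate predecessor of $b$) if $a<b$ and no element lies strictly between them. *)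

theory Defs
  imports Main
begin

(*
  The ordinals are the elements of a well-ordered type without greatest element, that is, of
  an arbitrary limit ordinal; HOL has no type of all ordinals. An ordinal \<alpha>, as a von Neumann
  set, is {..<\<alpha>}, so \<alpha> + 1 is {..\<alpha>}.
*)

definition ord_succ :: "'a::{wellorder,no_top} \<Rightarrow> 'a"
  where "ord_succ \<alpha> = (LEAST \<beta>. \<alpha> < \<beta>)"

definition ord_zero :: "'a::{wellorder,no_top}"
  where "ord_zero = (LEAST \<beta>. True)"

definition ord_one :: "'a::{wellorder,no_top}"
  where "ord_one = ord_succ ord_zero"

definition number :: "'a::{wellorder,no_top} set \<Rightarrow> bool"
  where "number x \<longleftrightarrow> (\<exists>\<mu>\<in>x. \<forall>\<beta>\<in>x. \<beta> \<le> \<mu>)"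

definition birth :: "'a::{wellorder,no_top} set \<Rightarrow> 'a"
  where "birth x = (GREATEST \<beta>. \<beta> \<in> x)"

definition NO :: "'a::{wellorder,no_top} \<Rightarrow> 'a set set"
  where "NO \<alpha> = {x. number x \<and> birth x < \<alpha>}"

definition num_less :: "'a::{wellorder,no_top} set \<Rightarrow> 'a set \<Rightarrow> bool"  (infix \<open>\<prec>\<close> 50)
  where "x \<prec> y \<longleftrightarrow> x \<noteq> y \<and> (LEAST \<gamma>. \<gamma> \<in> sym_diff x y) \<in> y"

definition num_le :: "'a::{wellorder,no_top} set \<Rightarrow> 'a set \<Rightarrow> bool"  (infix \<open>\<preceq>\<close> 50)
  where "x \<preceq> y \<longleftrightarrow> x \<prec> y \<or> x = y"

definition sharp :: "'a::{wellorder,no_top} set \<Rightarrow> 'a set"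
  where "sharp x = {\<alpha>. \<alpha> < birth x \<and> \<alpha> \<notin> x} \<union> {birth x}"

definition right_child :: "'a::{wellorder,no_top} set \<Rightarrow> 'a set"
  where "right_child x = x \<union> {ord_succ (birth x)}"

definition left_child :: "'a::{wellorder,no_top} set \<Rightarrow> 'a set"
  where "left_child x = (x \<union> {ord_succ (birth x)}) - {birth x}"

definition Co :: "'a::{wellorder,no_top} \<Rightarrow> 'a set"
  where "Co \<alpha> = {\<beta>. \<beta> \<le> \<alpha>}"

definition num_sgn :: "'a::{wellorder,no_top} set \<Rightarrow> int"
  where "num_sgn x = (if ord_zero \<in> x then 1 else - 1)"

definition tip :: "'a::{wellorder,no_top} set \<Rightarrow> 'a"
  where "tip x = (LEAST \<alpha>. \<alpha> \<in> x \<and> (ord_succ \<alpha> \<notin> x \<or> (\<exists>\<beta>. \<beta> \<notin> x \<and> \<alpha> = ord_succ \<beta>)))"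

definition immediate_succ_in :: "'a::{wellorder,no_top} set set \<Rightarrow> 'a set \<Rightarrow> 'a set \<Rightarrow> bool"
  where "immediate_succ_in S a b \<longleftrightarrow>
    a \<in> S \<and> b \<in> S \<and> a \<prec> b \<and> \<not> (\<exists>c\<in>S. a \<prec> c \<and> c \<prec> b)"

definition immediate_pred_in :: "'a::{wellorder,no_top} set set \<Rightarrow> 'a set \<Rightarrow> 'a set \<Rightarrow> bool"
  where "immediate_pred_in S b a \<longleftrightarrow> immediate_succ_in S a b"

definition maximal_in :: "'a::{wellorder,no_top} set set \<Rightarrow> 'a set \<Rightarrow> bool"
  where "maximal_in S m \<longleftrightarrow> m \<in> S \<and> \<not> (\<exists>x\<in>S. m \<prec> x)"

definition minimal_in :: "'a::{wellorder,no_top} set set \<Rightarrow> 'a set \<Rightarrow> bool"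
  where "minimal_in S m \<longleftrightarrow> m \<in> S \<and> \<not> (\<exists>x\<in>S. x \<prec> m)"

lemma num_less_iff:
  "x \<prec> y \<longleftrightarrow> (\<exists>\<gamma>. \<gamma> \<in> y \<and> \<gamma> \<notin> x \<and> (\<forall>\<beta><\<gamma>. \<beta> \<in> x \<longleftrightarrow> \<beta> \<in> y))"
proof
  assume a: "x \<prec> y"
  define \<gamma> where "\<gamma> = (LEAST \<gamma>. \<gamma> \<in> sym_diff x y)"
  from a have "\<exists>\<beta>. \<beta> \<in> sym_diff x y" "\<gamma> \<in> y" by (auto simp: num_less_def \<gamma>_def)
  then have "\<gamma> \<in> sym_diff x y" unfolding \<gamma>_def by (metis (mono_tags, lifting) LeastI_ex)
  moreover have "\<forall>\<beta><\<gamma>. \<beta> \<notin> sym_diff x y" unfolding \<gamma>_def using not_less_Least by blast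
  ultimately show "\<exists>\<gamma>. \<gamma> \<in> y \<and> \<gamma> \<notin> x \<and> (\<forall>\<beta><\<gamma>. \<beta> \<in> x \<longleftrightarrow> \<beta> \<in> y)" using \<open>\<gamma> \<in> y\<close> by blast
next
  assume "\<exists>\<gamma>. \<gamma> \<in> y \<and> \<gamma> \<notin> x \<and> (\<forall>\<beta><\<gamma>. \<beta> \<in> x \<longleftrightarrow> \<beta> \<in> y)"
  then obtain \<gamma> where g: "\<gamma> \<in> y" "\<gamma> \<notin> x" "\<forall>\<beta><\<gamma>. \<beta> \<in> x \<longleftrightarrow> \<beta> \<in> y" by blast
  have "(LEAST \<gamma>. \<gamma> \<in> sym_diff x y) = \<gamma>"
    by (rule Least_equality) (use g in \<open>auto simp: not_less[symmetric]\<close>)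
  with g show "x \<prec> y" unfolding num_less_def by auto
qed

lemma num_less_trans: "x \<prec> y \<Longrightarrow> y \<prec> z \<Longrightarrow> x \<prec> z"
  unfolding num_less_iff
proof (elim exE conjE)
  fix c d
  assume c: "c \<in> y" "c \<notin> x" "\<forall>\<beta><c. \<beta> \<in> x \<longleftrightarrow> \<beta> \<in> y"
    and d: "d \<in> z" "d \<notin> y" "\<forall>\<beta><d. \<beta> \<in> y \<longleftrightarrow> \<beta> \<in> z"
  have "min c d \<in> z \<and> min c d \<notin> x \<and> (\<forall>\<beta><min c d. \<beta> \<in> x \<longleftrightarrow> \<beta> \<in> z)"
    using c d by (cases c d rule: linorder_cases) (auto simp: min_def)
  then show "\<exists>\<gamma>. \<gamma> \<in> z \<and> \<gamma> \<notin> x \<and> (\<forall>\<beta><\<gamma>. \<beta> \<in> x \<longleftrightarrow> \<beta> \<in> z)" by blast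
qed

lemma num_less_irrefl: "\<not> x \<prec> x"
  by (simp add: num_less_def)

lemma num_less_linear: "x \<prec> y \<or> x = y \<or> y \<prec> x"
proof (cases "x = y")
  case False
  then have "\<exists>\<beta>. \<beta> \<in> sym_diff x y" by blast
  then have "(LEAST \<gamma>. \<gamma> \<in> sym_diff x y) \<in> sym_diff x y" by (rule LeastI_ex)
  then show ?thesis using False by (auto simp: num_less_def Un_commute)
qed simp

lemma num_linorder: "class.linorder (\<preceq>) (\<prec>)"
  by standard (use num_less_trans num_less_irrefl num_less_linear in \<open>unfold num_le_def, blast+\<close>)

end

theory Submission
  imports Defs
begin

text \<open>
  Everything follows from locating the least point at which two sets differ: the larger set is the
  one that contains it. A proper superset therefore lies above. A set strictly between a number
  with birthday \<open>b\<close> and one of its children agrees with both below the point where these two part,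
  and with one of them at that point; up to \<open>b + 1\<close> there is then no later point at which it could
  deviate from that one in the required direction. The set \<open>Co \<alpha>\<close> contains every ordinal up to
  \<open>\<alpha>\<close>, so a set above it can depart from it only beyond \<open>\<alpha>\<close> and hence contains it
  (\<open>Co_le_iff_subset\<close>); the comparisons with \<open>0\<close> and \<open>1\<close> are instances. Dually, a set whose
  elements are at most \<open>\<alpha>\<close> is a subset of \<open>Co \<alpha>\<close>, so it does not lie above it.

  The map \<open>sharp\<close> complements below the birthday and preserves the birthday, hence it is an
  involution. For order reversal one follows the first difference \<open>\<gamma>\<close> of \<open>x \<prec> y\<close>. If both
  birthdays lie beyond \<open>\<gamma>\<close>, complementation turns \<open>\<gamma> \<in> y - x\<close> into \<open>\<gamma> \<in> sharp x - sharp y\<close>.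
  Otherwise one of the two numbers ends at or before \<open>\<gamma>\<close> while the other goes on; the birthday
  of the shorter one is kept, not complemented, and needs separate care (\<open>sharp_antimono\<close>).
\<close>

section \<open>Ordinals and birthdays\<close>

lemma ord_succ_le_iff: "ord_succ \<alpha> \<le> \<beta> \<longleftrightarrow> \<alpha> < \<beta>"
proof -
  have "\<alpha> < ord_succ \<alpha>"
    unfolding ord_succ_def using gt_ex[of \<alpha>] by (rule LeastI_ex)
  moreover have "\<alpha> < \<beta> \<Longrightarrow> ord_succ \<alpha> \<le> \<beta>"
    unfolding ord_succ_def by (rule Least_le)
  ultimately show ?thesis by auto
qed

lemma less_ord_succ_iff: "\<beta> < ord_succ \<alpha> \<longleftrightarrow> \<beta> \<le> \<alpha>"
  using ord_succ_le_iff[of \<alpha> \<beta>] by auto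

lemma ord_zero_le: "ord_zero \<le> \<alpha>"
  unfolding ord_zero_def by (rule Least_le) simp

lemma le_ord_one_iff: "\<beta> \<le> ord_one \<longleftrightarrow> \<beta> = ord_zero \<or> \<beta> = ord_one"
proof (cases "\<beta> = ord_zero")
  case True
  then show ?thesis by (simp add: ord_zero_le)
next
  case False
  then have "ord_zero < \<beta>" using ord_zero_le[of \<beta>] by simp
  then have "ord_one \<le> \<beta>" by (simp add: ord_one_def ord_succ_le_iff)
  then show ?thesis using False by auto
qed

lemma birth_eqI: "\<mu> \<in> x \<Longrightarrow> (\<And>\<beta>. \<beta> \<in> x \<Longrightarrow> \<beta> \<le> \<mu>) \<Longrightarrow> birth x = \<mu>"
  unfolding birth_def by (rule Greatest_equality)

lemma
  assumes "number x"
  shows birth_mem: "birth x \<in> x"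
    and le_birth: "\<beta> \<in> x \<Longrightarrow> \<beta> \<le> birth x"
proof -
  obtain \<mu> where \<mu>: "\<mu> \<in> x" "\<forall>\<beta>\<in>x. \<beta> \<le> \<mu>" using assms unfolding number_def by blast
  then have "birth x = \<mu>" by (blast intro: birth_eqI)
  with \<mu> show "birth x \<in> x" "\<beta> \<in> x \<Longrightarrow> \<beta> \<le> birth x" by auto
qed

lemma number_birth_iff: "number x \<and> birth x = \<mu> \<longleftrightarrow> \<mu> \<in> x \<and> (\<forall>\<beta>\<in>x. \<beta> \<le> \<mu>)"
  using birth_mem[of x] le_birth[of x] birth_eqI[of \<mu> x] unfolding number_def by blast

lemma mem_NO_ord_succ:
  "x \<in> NO (ord_succ \<alpha>) \<longleftrightarrow> number x \<and> (\<forall>\<beta>\<in>x. \<beta> \<le> \<alpha>)"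
proof (cases "number x")
  case True
  then have "birth x \<le> \<alpha> \<longleftrightarrow> (\<forall>\<beta>\<in>x. \<beta> \<le> \<alpha>)"
    using birth_mem le_birth order.trans by blast
  with True show ?thesis by (simp add: NO_def less_ord_succ_iff)
qed (simp add: NO_def)

section \<open>The order and inclusion\<close>

lemma num_lessI:
  assumes "\<gamma> \<in> y" "\<gamma> \<notin> x" "\<And>\<beta>. \<beta> < \<gamma> \<Longrightarrow> \<beta> \<in> x \<longleftrightarrow> \<beta> \<in> y"
  shows "x \<prec> y"
  unfolding num_less_iff using assms by blast

lemma not_num_less_iff: "\<not> x \<prec> y \<longleftrightarrow> y \<preceq> x"
  unfolding num_le_def
  using num_less_linear[of x y] num_less_trans[of x y x] num_less_irrefl[of x] by auto

lemma subset_imp_num_le: "x \<subseteq> y \<Longrightarrow> x \<preceq> y"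
  unfolding not_num_less_iff[symmetric] num_less_iff by blast

text \<open>
  A set above \<open>Co \<alpha>\<close> has its first difference from \<open>Co \<alpha>\<close> outside \<open>Co \<alpha>\<close>, that is, beyond \<open>\<alpha>\<close>.
\<close>

lemma Co_le_iff_subset: "Co \<alpha> \<preceq> x \<longleftrightarrow> Co \<alpha> \<subseteq> x"
proof
  assume "Co \<alpha> \<preceq> x"
  then consider "Co \<alpha> = x" | "Co \<alpha> \<prec> x" unfolding num_le_def by blast
  then show "Co \<alpha> \<subseteq> x"
  proof cases
    case 2
    then obtain \<gamma> where "\<gamma> \<notin> Co \<alpha>" "\<And>\<beta>. \<beta> < \<gamma> \<Longrightarrow> \<beta> \<in> Co \<alpha> \<longleftrightarrow> \<beta> \<in> x"
      unfolding num_less_iff by blast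
    then show ?thesis unfolding Co_def by (auto dest: le_less_trans simp: not_le)
  qed simp
qed (rule subset_imp_num_le)

lemma Co_ord_zero: "Co ord_zero = {ord_zero}"
  unfolding Co_def using ord_zero_le by (auto intro: order.antisym)

lemma Co_ord_one: "Co ord_one = {ord_zero, ord_one}"
  unfolding Co_def by (auto simp: le_ord_one_iff)

text \<open>
  The tipping element exists because the birthday satisfies its defining condition; at \<open>0\<close> that
  condition reduces to its first alternative, since \<open>0\<close> is not a successor.
\<close>

lemma tip_eq_ord_zero_iff:
  assumes "number x"
  shows "tip x = ord_zero \<longleftrightarrow> ord_zero \<in> x \<and> ord_one \<notin> x"
proof
  assume t: "tip x = ord_zero"
  let ?P = "\<lambda>\<alpha>. \<alpha> \<in> x \<and> (ord_succ \<alpha> \<notin> x \<or> (\<exists>\<beta>. \<beta> \<notin> x \<and> \<alpha> = ord_succ \<beta>))"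
  have "?P (birth x)"
    using birth_mem[OF assms] le_birth[OF assms, of "ord_succ (birth x)"]
    by (auto simp: ord_succ_le_iff)
  then have "?P (tip x)" unfolding tip_def by (rule LeastI)
  moreover have "ord_zero \<noteq> ord_succ \<beta>" for \<beta> :: 'a
    using ord_succ_le_iff[of \<beta> ord_zero] ord_zero_le[of \<beta>] by auto
  ultimately show "ord_zero \<in> x \<and> ord_one \<notin> x" unfolding t ord_one_def by auto
next
  assume "ord_zero \<in> x \<and> ord_one \<notin> x"
  then show "tip x = ord_zero"
    unfolding tip_def ord_one_def by (intro Least_equality) (auto intro: ord_zero_le)
qed

lemma maximal_in_Co: "maximal_in (NO (ord_succ \<alpha>)) (Co \<alpha>)"
proof -
  have "x \<preceq> Co \<alpha>" if "x \<in> NO (ord_succ \<alpha>)" for x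
    using that by (intro subset_imp_num_le) (auto simp: mem_NO_ord_succ Co_def)
  moreover have "Co \<alpha> \<in> NO (ord_succ \<alpha>)"
    by (auto simp: mem_NO_ord_succ Co_def number_def)
  ultimately show ?thesis unfolding maximal_in_def by (metis not_num_less_iff)
qed

text \<open>A set below \<open>{\<alpha>}\<close> has no element up to \<open>\<alpha>\<close>.\<close>

lemma minimal_in_singleton: "minimal_in (NO (ord_succ \<alpha>)) {\<alpha>}"
  unfolding minimal_in_def
proof (intro conjI notI)
  show "{\<alpha>} \<in> NO (ord_succ \<alpha>)" by (simp add: mem_NO_ord_succ number_def)
  assume "\<exists>x\<in>NO (ord_succ \<alpha>). x \<prec> {\<alpha>}"
  then obtain x where x: "number x" "\<forall>\<beta>\<in>x. \<beta> \<le> \<alpha>" and less: "x \<prec> {\<alpha>}"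
    by (auto simp: mem_NO_ord_succ)
  from less have "\<alpha> \<notin> x" "\<And>\<beta>. \<beta> < \<alpha> \<Longrightarrow> \<beta> \<notin> x"
    unfolding num_less_iff by auto
  with x(2) birth_mem[OF x(1)] show False by (metis order.order_iff_strict)
qed

section \<open>Children\<close>

text \<open>
  A set above \<open>x\<close> but below \<open>right_child x\<close> first differs from \<open>x\<close> at some \<open>\<gamma>\<close> that it contains.
  A point \<open>\<gamma>\<close> up to \<open>b\<close> would put the set above \<open>right_child x\<close> as well; \<open>\<gamma> = b + 1\<close>
  makes it contain \<open>right_child x\<close>; and it has no elements beyond \<open>b + 1\<close>.
\<close>

lemma right_child_immediate_succ:
  assumes x: "number x"
  shows "immediate_succ_in (NO (ord_succ (ord_succ (birth x)))) x (right_child x)"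
  unfolding immediate_succ_in_def
proof (intro conjI)
  let ?b = "birth x" and ?s = "ord_succ (birth x)" and ?r = "right_child x"
  have bs: "?b < ?s" using ord_succ_le_iff by blast
  have below: "\<beta> < ?s" if "\<beta> \<in> x" for \<beta> using le_birth[OF x that] bs by simp
  then show "x \<in> NO (ord_succ ?s)" using x
    by (auto simp: mem_NO_ord_succ intro: less_imp_le)
  show "?r \<in> NO (ord_succ ?s)"
    using below by (fastforce simp: mem_NO_ord_succ number_def right_child_def)
  show "x \<prec> ?r"
    by (rule num_lessI[of ?s]) (use below in \<open>auto simp: right_child_def\<close>)
  show "\<not> (\<exists>c\<in>NO (ord_succ ?s). x \<prec> c \<and> c \<prec> ?r)"
  proof (rule notI, elim bexE conjE)
    fix c assume c: "c \<in> NO (ord_succ ?s)" "x \<prec> c" "c \<prec> ?r"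
    from c(2) obtain \<gamma> where \<gamma>: "\<gamma> \<in> c" "\<gamma> \<notin> x" "\<And>\<beta>. \<beta> < \<gamma> \<Longrightarrow> \<beta> \<in> x \<longleftrightarrow> \<beta> \<in> c"
      unfolding num_less_iff by blast
    have "?r \<preceq> c"
    proof (cases "\<gamma> = ?s")
      case True
      then have "?r \<subseteq> c" using \<gamma> below by (auto simp: right_child_def)
      then show ?thesis by (rule subset_imp_num_le)
    next
      case False
      then have "\<gamma> < ?s" using c(1) \<gamma>(1) by (auto simp: mem_NO_ord_succ order.order_iff_strict)
      then have "?r \<prec> c"
        by (intro num_lessI[of \<gamma>]) (use \<gamma> in \<open>auto simp: right_child_def\<close>)
      then show ?thesis by (simp add: num_le_def)
    qed
    with c(3) show False by (simp add: not_num_less_iff[symmetric])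
  qed
qed

text \<open>
  A set \<open>c\<close> below \<open>x\<close> first differs from \<open>x\<close> at some \<open>\<gamma> \<in> x - c\<close>. If \<open>\<gamma> < b\<close>, then \<open>\<gamma>\<close> also
  belongs to \<open>left_child x\<close>, which is therefore above \<open>c\<close>. If \<open>\<gamma> = b\<close>, then below \<open>b + 1\<close> the set
  \<open>c\<close> coincides with \<open>left_child x\<close>, which also contains the only remaining possible element \<open>b + 1\<close>.
\<close>

lemma left_child_immediate_pred:
  assumes x: "number x"
  shows "immediate_pred_in (NO (ord_succ (ord_succ (birth x)))) x (left_child x)"
  unfolding immediate_pred_in_def immediate_succ_in_def
proof (intro conjI)
  let ?b = "birth x" and ?s = "ord_succ (birth x)" and ?l = "left_child x"
  have bs: "?b < ?s" using ord_succ_le_iff by blast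
  have below: "\<beta> < ?s" if "\<beta> \<in> x" for \<beta> using le_birth[OF x that] bs by simp
  then show "x \<in> NO (ord_succ ?s)" using x
    by (auto simp: mem_NO_ord_succ intro: less_imp_le)
  show "?l \<in> NO (ord_succ ?s)"
    using below bs by (fastforce simp: mem_NO_ord_succ number_def left_child_def)
  show "?l \<prec> x"
    by (rule num_lessI[of ?b]) (use birth_mem[OF x] bs in \<open>auto simp: left_child_def\<close>)
  show "\<not> (\<exists>c\<in>NO (ord_succ ?s). ?l \<prec> c \<and> c \<prec> x)"
  proof (rule notI, elim bexE conjE)
    fix c assume c: "c \<in> NO (ord_succ ?s)" "?l \<prec> c" "c \<prec> x"
    from c(3) obtain \<gamma> where \<gamma>: "\<gamma> \<in> x" "\<gamma> \<notin> c" "\<And>\<beta>. \<beta> < \<gamma> \<Longrightarrow> \<beta> \<in> c \<longleftrightarrow> \<beta> \<in> x"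
      unfolding num_less_iff by blast
    have "c \<preceq> ?l"
    proof (cases "\<gamma> = ?b")
      case True
      have "\<beta> \<in> ?l" if "\<beta> \<in> c" for \<beta>
      proof (cases "\<beta> < ?b")
        case True
        then show ?thesis using \<gamma>(3)[of \<beta>] \<open>\<gamma> = ?b\<close> that by (auto simp: left_child_def)
      next
        case False
        moreover have "\<beta> \<noteq> ?b" using that True \<gamma>(2) by blast
        ultimately have "?b < \<beta>" by simp
        then have "\<beta> = ?s" using c(1) that ord_succ_le_iff[of ?b \<beta>]
          by (auto simp: mem_NO_ord_succ intro: order.antisym)
        then show ?thesis using bs by (auto simp: left_child_def)
      qed
      then show ?thesis by (intro subset_imp_num_le) blast
    next
      case False
      then have "\<gamma> < ?b" using le_birth[OF x \<gamma>(1)] by simp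
      then have "c \<prec> ?l"
        by (intro num_lessI[of \<gamma>]) (use \<gamma> bs in \<open>auto simp: left_child_def\<close>)
      then show ?thesis by (simp add: num_le_def)
    qed
    with c(2) show False by (simp add: not_num_less_iff[symmetric])
  qed
qed

section \<open>Reflection\<close>

lemma number_birth_sharp: "number (sharp x) \<and> birth (sharp x) = birth x"
  by (auto simp: number_birth_iff sharp_def)

lemma sharp_sharp:
  assumes "number x"
  shows "sharp (sharp x) = x"
proof -
  have "sharp (sharp x) = {\<alpha>. \<alpha> < birth x \<and> \<alpha> \<notin> sharp x} \<union> {birth x}"
    by (simp add: sharp_def[of "sharp x"] number_birth_sharp)
  also have "\<dots> = x"
    using birth_mem[OF assms] le_birth[OF assms] by (auto simp: sharp_def order.order_iff_strict)
  finally show ?thesis .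
qed

lemma mem_sharp_less: "\<beta> < birth x \<Longrightarrow> \<beta> \<in> sharp x \<longleftrightarrow> \<beta> \<notin> x"
  by (auto simp: sharp_def)

lemma birth_mem_sharp: "birth x \<in> sharp x"
  by (simp add: sharp_def)

text \<open>
  With \<open>\<gamma>\<close> the first difference, \<open>\<gamma> \<in> y - x\<close>, the decisive point after complementation is:
  \<open>birth x\<close>, if \<open>x\<close> ends before \<open>\<gamma>\<close>, because \<open>birth x\<close> lies in \<open>y\<close> strictly below \<open>birth y\<close>;
  \<open>\<gamma>\<close>, if both birthdays are beyond it. If \<open>y\<close> ends at \<open>\<gamma>\<close> and \<open>x\<close> goes on, \<open>sharp y\<close> and
  \<open>sharp x\<close> agree up to \<open>\<gamma>\<close>, which both contain, and only \<open>sharp x\<close> has elements beyond.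
\<close>

lemma sharp_antimono:
  assumes x: "number x" and y: "number y" and "x \<prec> y"
  shows "sharp y \<prec> sharp x"
proof -
  from \<open>x \<prec> y\<close> obtain \<gamma>
    where \<gamma>: "\<gamma> \<in> y" "\<gamma> \<notin> x" "\<And>\<beta>. \<beta> < \<gamma> \<Longrightarrow> \<beta> \<in> x \<longleftrightarrow> \<beta> \<in> y"
    unfolding num_less_iff by blast
  have \<gamma>y: "\<gamma> \<le> birth y" using y \<gamma>(1) by (rule le_birth)
  have "birth x \<noteq> \<gamma>" using birth_mem[OF x] \<gamma>(2) by blast
  then consider "birth x < \<gamma>" | "\<gamma> < birth x" "\<gamma> < birth y" | "\<gamma> < birth x" "\<gamma> = birth y"
    using \<gamma>y by fastforce
  then show ?thesis
  proof cases
    case 1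
    show ?thesis
    proof (rule num_lessI)
      show "birth x \<in> sharp x" by (rule birth_mem_sharp)
      show "birth x \<notin> sharp y" using 1 \<gamma>y \<gamma>(3) birth_mem[OF x] by (simp add: mem_sharp_less)
      show "\<beta> \<in> sharp y \<longleftrightarrow> \<beta> \<in> sharp x" if "\<beta> < birth x" for \<beta>
        using that 1 \<gamma>y \<gamma>(3) by (simp add: mem_sharp_less)
    qed
  next
    case 2
    then show ?thesis
      by (intro num_lessI[of \<gamma>]) (use \<gamma> in \<open>auto simp: mem_sharp_less\<close>)
  next
    case 3
    then have "sharp y \<subseteq> sharp x" using \<gamma> by (auto simp: sharp_def)
    then have "sharp y \<preceq> sharp x" by (rule subset_imp_num_le)
    moreover have "sharp y \<noteq> sharp x"
      using 3 number_birth_sharp[of x] number_birth_sharp[of y] by auto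
    ultimately show ?thesis by (simp add: num_le_def)
  qed
qed

text \<open>Since \<open>\<prec>\<close> is total, a strictly antitone map also reflects the order.\<close>

lemma sharp_le_sharp_iff:
  assumes "number x" "number y"
  shows "sharp y \<preceq> sharp x \<longleftrightarrow> x \<preceq> y"
  using sharp_antimono[OF assms] sharp_antimono[OF assms(2,1)]
  by (metis not_num_less_iff num_le_def)

lemma bij_betw_sharp: "bij_betw sharp {x. number x} {x. number x}"
  by (rule bij_betw_byWitness[where f' = sharp]) (auto simp: sharp_sharp number_birth_sharp)

lemma sharp_Co_ord_zero: "sharp (Co ord_zero) = Co ord_zero"
proof -
  have "birth (Co ord_zero) = (ord_zero :: 'a)"
    by (rule birth_eqI) (auto simp: Co_ord_zero)
  then show ?thesis using ord_zero_le by (auto simp: sharp_def Co_ord_zero not_less[symmetric])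
qed

section \<open>Properties of the order on numbers\<close>

theorem theorem2p26:
  shows
    "(\<forall>x y :: 'a::{wellorder,no_top} set.
        number x \<and> number y \<and> x \<subseteq> y \<longrightarrow> x \<preceq> y)
   \<and> (bij_betw sharp {x :: 'a set. number x} {x :: 'a set. number x}
      \<and> (\<forall>x y :: 'a set. number x \<and> number y \<longrightarrow> (x \<preceq> y \<longleftrightarrow> sharp y \<preceq> sharp x))
      \<and> sharp (Co (ord_zero :: 'a)) = Co ord_zero)
   \<and> (\<forall>(\<alpha> :: 'a) (x :: 'a set). number x \<and> birth x = \<alpha> \<longrightarrow>
        immediate_succ_in (NO (ord_succ (ord_succ \<alpha>))) x (right_child x)
      \<and> immediate_pred_in (NO (ord_succ (ord_succ \<alpha>))) x (left_child x))
   \<and> (\<forall>x :: 'a set. number x \<longrightarrow>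
        ((Co ord_zero \<preceq> x \<longleftrightarrow> ord_zero \<in> x) \<and> (ord_zero \<in> x \<longleftrightarrow> num_sgn x = 1))
      \<and> ((Co ord_zero \<preceq> x \<and> x \<prec> Co ord_one \<longleftrightarrow> ord_zero \<in> x \<and> ord_one \<notin> x)
         \<and> (ord_zero \<in> x \<and> ord_one \<notin> x \<longleftrightarrow> tip x = ord_zero))
      \<and> (Co ord_one \<preceq> x \<longleftrightarrow> {ord_zero, ord_one} \<subseteq> x)
      \<and> (\<forall>\<alpha>. Co \<alpha> \<preceq> x \<longleftrightarrow> Co \<alpha> \<subseteq> x))
   \<and> (\<forall>\<alpha> :: 'a. maximal_in (NO (ord_succ \<alpha>)) (Co \<alpha>)
               \<and> minimal_in (NO (ord_succ \<alpha>)) {\<alpha>})"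
proof (intro conjI allI impI; (elim conjE)?)
  fix x :: "'a set"
  assume x: "number x"
  show zero: "Co ord_zero \<preceq> x \<longleftrightarrow> ord_zero \<in> x"
    by (subst Co_le_iff_subset) (simp add: Co_ord_zero)
  show one: "Co ord_one \<preceq> x \<longleftrightarrow> {ord_zero, ord_one} \<subseteq> x"
    by (subst Co_le_iff_subset) (simp only: Co_ord_one)
  have "x \<prec> Co ord_one \<longleftrightarrow> \<not> Co ord_one \<preceq> x"
    using not_num_less_iff by blast
  then show "Co ord_zero \<preceq> x \<and> x \<prec> Co ord_one \<longleftrightarrow> ord_zero \<in> x \<and> ord_one \<notin> x"
    using zero one by blast
  show "ord_zero \<in> x \<longleftrightarrow> num_sgn x = 1"
    by (simp add: num_sgn_def)
  show "ord_zero \<in> x \<and> ord_one \<notin> x \<longleftrightarrow> tip x = ord_zero"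
    using tip_eq_ord_zero_iff[OF x] by blast
qed (auto simp: subset_imp_num_le bij_betw_sharp sharp_le_sharp_iff sharp_Co_ord_zero
    right_child_immediate_succ left_child_immediate_pred Co_le_iff_subset
    maximal_in_Co minimal_in_singleton)

end
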